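(* Let $X \in \mathbb{R}^{p_1\times\cdots\times p_K\times n}$ and let $X = \ell (L_1,\ldots,L_K,I_n) \cdot Q$ be an incredible HOLQ of $X$. Then the core array $Q$ is scaled all-orthonormal, i.e. $$Q_{(k)}Q_{(k)}^T = I_{p_k}/p_k \quad \text{for all } k = 1,\ldots,K.$$
   Context: $\mathcal{G}_{p}^+$ denotes the set of $p \times p$ real lower triangular matrices with positive diagonal elements and unit determinant; $\|\cdot\|$ is the Frobenius norm (square root of the sum of squared entries). For matrices $A_k \in \mathbb{R}^{p_k \times p_k}$ and an array $Y \in \mathbb{R}^{p_1\times\cdots\times p_K\times n}$, multilinear multiplication $(A_1,\ldots,A_K,I_n)\cdot Y$ is the array of the same dimensions with entries $$\sum_{i_1,\ldots,i_K=1}^{p_1,\ldots,p_K} Y_{[i_1,\ldots,i_K,j_{K+1}]}\,A_{1[j_1,i_1]}\cdots A_{K[j_K,i_K]}.$$ For $k=1,\dots,K$, $Y_{(k)}$ is the mode-$k$ unfolding of $Y$ into a $p_k \times n\prod_{i\ne k}p_i$ matrix, whose row $j$ is the vectorization of the slice of $Y$ with $k$th index equal to $j$. Incredible HOLQ: if $(L_1,\ldots,L_K)$ attains the minimum $$(L_1,\ldots,L_K) = \operatorname*{arg\,min}_{\tilde{L}_k \in \mathcal{G}_{p_k}^+,\ k = 1,\ldots,K}\| (\tilde{L}_1^{-1},\ldots,\tilde{L}_K^{-1},I_n) \cdot X\|,$$ then $X = \ell (L_1,\ldots,L_K,I_n) \cdot Q$ is called an incredible HOLQ of $X$, where $\ell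 = \| (L_1^{-1},\ldots,L_K^{-1},I_n) \cdot X\|$ and $Q = (L_1^{-1},\ldots,L_K^{-1},I_n) \cdot X / \ell$. It is understood that $\ell>0$. (Such a minimizer need not exist for every $X$; the statement concerns arrays for which it does.) *)

theory Defs
  imports
    Complex_Main
    "HOL-Library.FuncSet"
    "Jordan_Normal_Form.Determinant"
    "Jordan_Normal_Form.Gauss_Jordan_Elimination"
begin

text \<open>
  All indices are 0-based. A real array of dimensions
  p 0, ..., p (K - 1), n is a function Y, where Y i j is the entry at the
  multi-index i in the first K modes and at j in the last mode. Values of Y outside
  the index ranges carry no meaning, so equality of arrays is \<open>array_eq\<close> below.
\<close>

type_synonym array = "(nat \<Rightarrow> nat) \<Rightarrow> nat \<Rightarrow> real"

definition multi_indices :: "nat \<Rightarrow> (nat \<Rightarrow> nat) \<Rightarrow> (nat \<Rightarrow> nat) set" where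
  "multi_indices K p = (\<Pi>\<^sub>E k\<in>{..<K}. {..<p k})"

definition array_eq :: "nat \<Rightarrow> (nat \<Rightarrow> nat) \<Rightarrow> nat \<Rightarrow> array \<Rightarrow> array \<Rightarrow> bool" where
  "array_eq K p n Y Z \<longleftrightarrow> (\<forall>i\<in>multi_indices K p. \<forall>j<n. Y i j = Z i j)"

definition frobenius_norm :: "nat \<Rightarrow> (nat \<Rightarrow> nat) \<Rightarrow> nat \<Rightarrow> array \<Rightarrow> real" where
  "frobenius_norm K p n Y = sqrt (\<Sum>i\<in>multi_indices K p. \<Sum>j<n. (Y i j)\<^sup>2)"

definition array_scale :: "real \<Rightarrow> array \<Rightarrow> array" where
  "array_scale c Y = (\<lambda>i j. c * Y i j)"

text \<open>The product (A 0, ..., A (K - 1), I_n) \<open>\<cdot>\<close> Y; the last mode is left unchanged.\<close>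

definition multilinear_mult ::
    "nat \<Rightarrow> (nat \<Rightarrow> nat) \<Rightarrow> (nat \<Rightarrow> real mat) \<Rightarrow> array \<Rightarrow> array" where
  "multilinear_mult K p A Y =
     (\<lambda>j l. \<Sum>i\<in>multi_indices K p. Y i l * (\<Prod>k<K. A k $$ (j k, i k)))"

text \<open>
  Mode-k unfolding. Row r is the vectorization of the slice with k-th index r, where
  earlier modes vary fastest: column c is the mixed-radix number whose digits, in
  the bases p m for m < K, m \<open>\<noteq>\<close> k, and finally n, are the remaining indices.
\<close>

definition unfolding_index ::
    "nat \<Rightarrow> (nat \<Rightarrow> nat) \<Rightarrow> nat \<Rightarrow> nat \<Rightarrow> nat \<Rightarrow> (nat \<Rightarrow> nat)" where
  "unfolding_index K p k r c =
     (\<lambda>m\<in>{..<K}. if m = k then r else (c div (\<Prod>i\<in>{..<m} - {k}. p i)) mod p m)"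

definition mode_unfolding ::
    "nat \<Rightarrow> (nat \<Rightarrow> nat) \<Rightarrow> nat \<Rightarrow> nat \<Rightarrow> array \<Rightarrow> real mat" where
  "mode_unfolding K p n k Y =
     mat (p k) (n * (\<Prod>i\<in>{..<K} - {k}. p i))
       (\<lambda>(r, c). Y (unfolding_index K p k r c) (c div (\<Prod>i\<in>{..<K} - {k}. p i)))"

definition G_plus :: "nat \<Rightarrow> real mat set" where
  "G_plus q = {A \<in> carrier_mat q q.
     (\<forall>i<q. \<forall>j<q. i < j \<longrightarrow> A $$ (i, j) = 0) \<and> (\<forall>i<q. 0 < A $$ (i, i)) \<and> det A = 1}"

definition matinv :: "real mat \<Rightarrow> real mat" where
  "matinv A = the (mat_inverse A)"

lemma matinv_G_plus:
  assumes "A \<in> G_plus q"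
  shows "A * matinv A = 1\<^sub>m q" "matinv A * A = 1\<^sub>m q" "matinv A \<in> carrier_mat q q"
proof -
  have A: "A \<in> carrier_mat q q" and "det A \<noteq> 0"
    using assms by (auto simp: G_plus_def)
  then have "A \<in> Units (ring_mat TYPE(real) q ())"
    by (rule det_non_zero_imp_unit)
  then obtain B where "mat_inverse A = Some B"
    using mat_inverse(1)[OF A, of "()"] by (cases "mat_inverse A") auto
  then show "A * matinv A = 1\<^sub>m q" "matinv A * A = 1\<^sub>m q" "matinv A \<in> carrier_mat q q"
    using mat_inverse(2)[OF A] by (auto simp: matinv_def)
qed

definition holq_minimizer ::
    "nat \<Rightarrow> (nat \<Rightarrow> nat) \<Rightarrow> nat \<Rightarrow> array \<Rightarrow> (nat \<Rightarrow> real mat) \<Rightarrow> bool" where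
  "holq_minimizer K p n X L \<longleftrightarrow>
     (\<forall>k<K. L k \<in> G_plus (p k)) \<and>
     (\<forall>M. (\<forall>k<K. M k \<in> G_plus (p k)) \<longrightarrow>
        frobenius_norm K p n (multilinear_mult K p (\<lambda>k. matinv (L k)) X)
          \<le> frobenius_norm K p n (multilinear_mult K p (\<lambda>k. matinv (M k)) X))"

definition incredible_holq ::
    "nat \<Rightarrow> (nat \<Rightarrow> nat) \<Rightarrow> nat \<Rightarrow> array \<Rightarrow> real \<Rightarrow> (nat \<Rightarrow> real mat) \<Rightarrow> array \<Rightarrow> bool" where
  "incredible_holq K p n X ell L Q \<longleftrightarrow>
     holq_minimizer K p n X L \<and>
     ell = frobenius_norm K p n (multilinear_mult K p (\<lambda>k. matinv (L k)) X) \<and>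
     ell > 0 \<and>
     array_eq K p n Q
       (array_scale (1 / ell) (multilinear_mult K p (\<lambda>k. matinv (L k)) X)) \<and>
     array_eq K p n X (array_scale ell (multilinear_mult K p L Q))"

definition scaled_all_orthonormal ::
    "nat \<Rightarrow> (nat \<Rightarrow> nat) \<Rightarrow> nat \<Rightarrow> array \<Rightarrow> bool" where
  "scaled_all_orthonormal K p n Q \<longleftrightarrow>
     (\<forall>k<K. mode_unfolding K p n k Q * transpose_mat (mode_unfolding K p n k Q)
        = (1 / real (p k)) \<cdot>\<^sub>m 1\<^sub>m (p k))"

end

theory Submission
  imports Defs
begin

text \<open>
Put \<open>T = (L\<^sub>0\<inverse>, \<dots>, I\<^sub>n) \<cdot> X\<close>, so that \<open>Q = T / \<ell>\<close> with \<open>\<ell> = \<parallel>T\<parallel>\<close>. Fix a mode \<open>k\<close> and let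
\<open>S = T\<^sub>(\<^sub>k\<^sub>) T\<^sub>(\<^sub>k\<^sub>)\<^sup>T\<close>. The feasible set is a group in each factor: if \<open>H\<close> lies in it and \<open>G H = I\<close>, then
replacing \<open>L\<^sub>k\<close> by \<open>L\<^sub>k H\<close> stays feasible and turns \<open>T\<^sub>(\<^sub>k\<^sub>)\<close> into \<open>G T\<^sub>(\<^sub>k\<^sub>)\<close>. Minimality
therefore says \<open>tr S \<le> tr (G S G\<^sup>T)\<close> for all such \<open>G\<close> (\<open>holq_minimizer_variation\<close>). Two
one-parameter families of \<open>G\<close> suffice.

\<^item> Adding \<open>t\<close> times row \<open>b\<close> to a later row \<open>a\<close> changes the trace by \<open>2 t S\<^sub>a\<^sub>b + t\<^sup>2 S\<^sub>b\<^sub>b\<close>. This is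
nonnegative for every real \<open>t\<close>, hence \<open>S\<^sub>a\<^sub>b = 0\<close> (\<open>holq_minimizer_gram_offdiag\<close>).

\<^item> Scaling row \<open>a\<close> by \<open>s\<close> and row \<open>b\<close> by \<open>1/s\<close> keeps the determinant equal to one and replaces
\<open>S\<^sub>a\<^sub>a + S\<^sub>b\<^sub>b\<close> by \<open>s\<^sup>2 S\<^sub>a\<^sub>a + S\<^sub>b\<^sub>b / s\<^sup>2\<close>. As \<open>s = 1\<close> is optimal, \<open>S\<^sub>a\<^sub>a = S\<^sub>b\<^sub>b\<close>
(\<open>holq_minimizer_gram_diag_le\<close>).

So \<open>S\<close> is a multiple of the identity. Its trace is \<open>\<parallel>T\<parallel>\<^sup>2 = \<ell>\<^sup>2\<close>, so \<open>S = (\<ell>\<^sup>2 / p\<^sub>k) I\<close>, and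
dividing by \<open>\<ell>\<^sup>2\<close> gives the Gram matrix of \<open>Q\<^sub>(\<^sub>k\<^sub>)\<close>. That the columns of an unfolding run
exactly once through the indices of the remaining modes is a statement about mixed-radix numerals
(\<open>bij_betw_unfolding_columns\<close>).
\<close>

section \<open>Slicing an array along one mode\<close>

definition other_indices :: "nat \<Rightarrow> (nat \<Rightarrow> nat) \<Rightarrow> nat \<Rightarrow> (nat \<Rightarrow> nat) set" where
  "other_indices K p k = (\<Pi>\<^sub>E m\<in>{..<K} - {k}. {..<p m})"

text \<open>
The Gram matrix of the mode-\<open>k\<close> slices, indexed by multi-indices instead of by the columns of the
unfolding: the norm and the multilinear product are sums over multi-indices, so the variational
argument is carried out in this form.
\<close>

definition mode_gram ::
    "nat \<Rightarrow> (nat \<Rightarrow> nat) \<Rightarrow> nat \<Rightarrow> nat \<Rightarrow> array \<Rightarrow> nat \<Rightarrow> nat \<Rightarrow> real" where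
  "mode_gram K p n k Y a b =
     (\<Sum>r\<in>other_indices K p k. \<Sum>l<n. Y (r(k := a)) l * Y (r(k := b)) l)"

lemma bij_betw_slice:
  assumes "k < K"
  shows "bij_betw (\<lambda>(a, r). r(k := a)) ({..<p k} \<times> other_indices K p k) (multi_indices K p)"
proof -
  have *: "{..<K} = insert k ({..<K} - {k})"
    using assms by auto
  have "multi_indices K p = (\<lambda>(a, r). r(k := a)) ` ({..<p k} \<times> other_indices K p k)"
    unfolding multi_indices_def other_indices_def by (subst *) (rule PiE_insert_eq)
  moreover have "inj_on (\<lambda>(a, r). r(k := a)) ({..<p k} \<times> other_indices K p k)"
    unfolding other_indices_def by (rule inj_combinator) simp
  ultimately show ?thesis
    by (simp add: bij_betw_def)
qed

lemma sum_multi_indices_slice: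
  assumes "k < K"
  shows "sum f (multi_indices K p) = (\<Sum>a<p k. \<Sum>r\<in>other_indices K p k. f (r(k := a)))"
  by (subst sum.reindex_bij_betw[OF bij_betw_slice[OF assms], symmetric])
     (simp add: sum.cartesian_product case_prod_unfold)

lemma slice_in_multi_indices:
  assumes "k < K" "a < p k" "r \<in> other_indices K p k"
  shows "r(k := a) \<in> multi_indices K p"
  using bij_betw_imp_surj_on[OF bij_betw_slice[OF assms(1), of p]] assms by force

lemma frobenius_norm_slice:
  assumes "k < K"
  shows "(frobenius_norm K p n Y)\<^sup>2 =
    (\<Sum>a<p k. \<Sum>r\<in>other_indices K p k. \<Sum>l<n. (Y (r(k := a)) l)\<^sup>2)"
proof -
  have "(frobenius_norm K p n Y)\<^sup>2 = (\<Sum>i\<in>multi_indices K p. \<Sum>j<n. (Y i j)\<^sup>2)"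
    unfolding frobenius_norm_def by (rule real_sqrt_pow2) (intro sum_nonneg; simp)
  then show ?thesis
    by (simp add: sum_multi_indices_slice[OF assms])
qed

lemma frobenius_norm_eq_trace_mode_gram:
  assumes "k < K"
  shows "(frobenius_norm K p n Y)\<^sup>2 = (\<Sum>a<p k. mode_gram K p n k Y a a)"
  unfolding frobenius_norm_slice[OF assms] by (simp add: mode_gram_def power2_eq_square)

lemma mode_gram_commute: "mode_gram K p n k Y a b = mode_gram K p n k Y b a"
  by (simp add: mode_gram_def mult.commute)

lemma mode_gram_diag_nonneg: "0 \<le> mode_gram K p n k Y a a"
  unfolding mode_gram_def by (intro sum_nonneg) simp

section \<open>The Gram matrix of an unfolding\<close>

text \<open>
The mixed-radix digits of \<open>c\<close> up to position \<open>K\<close> determine \<open>c\<close> modulo the product of the bases, since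
\<open>c mod (P q) = P (c div P mod q) + c mod P\<close> appends one digit. Comparing residues instead of
bounded numbers makes the induction go through for arbitrary \<open>c\<close>, and skipping position \<open>k\<close> leaves
the product unchanged.
\<close>

lemma mod_prod_eq_if_digits_eq:
  fixes p :: "nat \<Rightarrow> nat"
  assumes "\<And>m. m < K \<Longrightarrow> m \<noteq> k \<Longrightarrow>
    c div (\<Prod>i\<in>{..<m} - {k}. p i) mod p m = c' div (\<Prod>i\<in>{..<m} - {k}. p i) mod p m"
  shows "c mod (\<Prod>i\<in>{..<K} - {k}. p i) = c' mod (\<Prod>i\<in>{..<K} - {k}. p i)"
  using assms
proof (induction K)
  case 0
  then show ?case by simp
next
  case (Suc K)
  have IH: "c mod (\<Prod>i\<in>{..<K} - {k}. p i) = c' mod (\<Prod>i\<in>{..<K} - {k}. p i)"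
    using Suc by simp
  show ?case
  proof (cases "K = k")
    case True
    then have "{..<Suc K} - {k} = {..<K} - {k}" by auto
    then show ?thesis using IH by simp
  next
    case False
    then have "{..<Suc K} - {k} = insert K ({..<K} - {k})" by auto
    then have "(\<Prod>i\<in>{..<Suc K} - {k}. p i) = (\<Prod>i\<in>{..<K} - {k}. p i) * p K"
      by (simp add: mult.commute)
    then show ?thesis
      using IH Suc.prems[of K] False by (simp add: mod_mult2_eq)
  qed
qed

text \<open>
Injectivity is uniqueness of mixed-radix digits, where \<open>c div P K k\<close> is the leading digit;
surjectivity follows by counting, as both sides have \<open>n\<close> times the product of the bases many elements.
\<close>

lemma bij_betw_unfolding_columns:
  fixes p :: "nat \<Rightarrow> nat"
  defines "P \<equiv> (\<lambda>m k. \<Prod>i\<in>{..<m} - {k}. p i)"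
  shows "bij_betw (\<lambda>c. (\<lambda>m\<in>{..<K} - {k}. c div P m k mod p m, c div P K k))
    {..<n * P K k} (other_indices K p k \<times> {..<n})"
    (is "bij_betw ?f ?A ?B")
proof -
  have inj: "inj_on ?f ?A"
  proof (rule inj_onI)
    fix c c' assume eq: "?f c = ?f c'"
    have "c div P m k mod p m = c' div P m k mod p m" if "m < K" "m \<noteq> k" for m
      using fun_cong[OF arg_cong[OF eq, of fst], of m] that by simp
    then have "c mod P K k = c' mod P K k"
      unfolding P_def by (rule mod_prod_eq_if_digits_eq)
    moreover have "c div P K k = c' div P K k"
      using eq by simp
    ultimately show "c = c'"
      by (metis div_mult_mod_eq)
  qed
  have sub: "?f ` ?A \<subseteq> ?B"
  proof (rule image_subsetI)
    fix c assume c: "c \<in> ?A"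
    then have "P K k \<noteq> 0"
      by (intro notI) simp
    then have "p m > 0" if "m < K" "m \<noteq> k" for m
      using that by (auto simp: P_def)
    moreover have "c div P K k < n"
      using c by (simp add: less_mult_imp_div_less)
    ultimately show "?f c \<in> ?B"
      by (auto simp: other_indices_def)
  qed
  have "finite ?B" and card: "card ?A = card ?B"
    by (simp_all add: other_indices_def P_def card_PiE finite_PiE)
  from this(1) sub have "?f ` ?A = ?B"
    by (rule card_subset_eq) (simp only: card_image[OF inj] card)
  with inj show ?thesis
    by (simp add: bij_betw_def)
qed

lemma unfolding_index_eq_slice:
  assumes "k < K"
  shows "unfolding_index K p k r c =
    (\<lambda>m\<in>{..<K} - {k}. c div (\<Prod>i\<in>{..<m} - {k}. p i) mod p m)(k := r)"
  using assms by (auto simp: unfolding_index_def fun_eq_iff)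

lemma mode_unfolding_gram:
  assumes "k < K"
  shows "mode_unfolding K p n k Y * transpose_mat (mode_unfolding K p n k Y) =
    mat (p k) (p k) (\<lambda>(a, b). mode_gram K p n k Y a b)"
proof (rule eq_matI)
  let ?P = "\<Prod>i\<in>{..<K} - {k}. p i"
  fix a b assume "a < dim_row (mat (p k) (p k) (\<lambda>(a, b). mode_gram K p n k Y a b))"
    "b < dim_col (mat (p k) (p k) (\<lambda>(a, b). mode_gram K p n k Y a b))"
  then have ab: "a < p k" "b < p k" by simp_all
  let ?g = "\<lambda>(r, l). Y (r(k := a)) l * Y (r(k := b)) l"
  have "(mode_unfolding K p n k Y * transpose_mat (mode_unfolding K p n k Y)) $$ (a, b) =
      (\<Sum>c<n * ?P. Y (unfolding_index K p k a c) (c div ?P) * Y (unfolding_index K p k b c) (c div ?P))"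
    using ab by (simp add: mode_unfolding_def scalar_prod_def atLeast0LessThan)
  also have "\<dots> = (\<Sum>c<n * ?P. ?g
      (\<lambda>m\<in>{..<K} - {k}. c div (\<Prod>i\<in>{..<m} - {k}. p i) mod p m, c div ?P))"
    by (simp add: unfolding_index_eq_slice[OF assms])
  also have "\<dots> = sum ?g (other_indices K p k \<times> {..<n})"
    by (rule sum.reindex_bij_betw[OF bij_betw_unfolding_columns])
  also have "\<dots> = mode_gram K p n k Y a b"
    by (simp add: mode_gram_def sum.cartesian_product)
  finally show "(mode_unfolding K p n k Y * transpose_mat (mode_unfolding K p n k Y)) $$ (a, b) =
      mat (p k) (p k) (\<lambda>(a, b). mode_gram K p n k Y a b) $$ (a, b)"
    using ab by simp
qed (simp_all add: mode_unfolding_def)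

section \<open>Perturbing one factor of a minimizer\<close>

text \<open>
Multiplying the factor of mode \<open>k\<close> by \<open>G\<close> from the left acts on the product as \<open>G\<close> acts on the rows
of its mode-\<open>k\<close> unfolding.
\<close>

lemma multilinear_mult_update:
  assumes k: "k < K" and G: "G \<in> carrier_mat (p k) (p k)" and A: "A k \<in> carrier_mat (p k) (p k)"
    and j: "j \<in> multi_indices K p"
  shows "multilinear_mult K p (A(k := G * A k)) Y j l =
    (\<Sum>b<p k. G $$ (j k, b) * multilinear_mult K p A Y (j(k := b)) l)"
proof -
  have prod_split: "(\<Prod>m<K. f m) = f k * (\<Prod>m\<in>{..<K} - {k}. f m)" for f :: "nat \<Rightarrow> real"
    using k by (simp add: prod.remove)
  have jk: "j k < p k"
    using j k by (auto simp: multi_indices_def)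
  have "Y i l * (\<Prod>m<K. (A(k := G * A k)) m $$ (j m, i m)) =
      (\<Sum>b<p k. G $$ (j k, b) * (Y i l * (\<Prod>m<K. A m $$ ((j(k := b)) m, i m))))"
    if i: "i \<in> multi_indices K p" for i
  proof -
    have ik: "i k < p k"
      using i k by (auto simp: multi_indices_def)
    have entry: "(G * A k) $$ (j k, i k) = (\<Sum>b<p k. G $$ (j k, b) * A k $$ (b, i k))"
      using G A jk ik by (simp add: scalar_prod_def atLeast0LessThan)
    have rest: "(\<Prod>m\<in>{..<K} - {k}. (A(k := B)) m $$ ((j(k := b)) m, i m)) =
        (\<Prod>m\<in>{..<K} - {k}. A m $$ (j m, i m))" for B b
      by (rule prod.cong) auto
    have rest1: "(\<Prod>m\<in>{..<K} - {k}. (A(k := B)) m $$ (j m, i m)) =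
        (\<Prod>m\<in>{..<K} - {k}. A m $$ (j m, i m))" for B
      using rest[of B "j k"] by simp
    have rest2: "(\<Prod>m\<in>{..<K} - {k}. A m $$ ((j(k := b)) m, i m)) =
        (\<Prod>m\<in>{..<K} - {k}. A m $$ (j m, i m))" for b
      using rest[of "A k" b] by simp
    show ?thesis
      unfolding prod_split rest1 rest2 fun_upd_same entry sum_distrib_left sum_distrib_right
      by (intro sum.cong refl) (simp only: mult_ac)
  qed
  then have "multilinear_mult K p (A(k := G * A k)) Y j l =
      (\<Sum>i\<in>multi_indices K p. \<Sum>b<p k.
        G $$ (j k, b) * (Y i l * (\<Prod>m<K. A m $$ ((j(k := b)) m, i m))))"
    unfolding multilinear_mult_def by (rule sum.cong[OF refl])
  also have "\<dots> = (\<Sum>b<p k. \<Sum>i\<in>multi_indices K p.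
        G $$ (j k, b) * (Y i l * (\<Prod>m<K. A m $$ ((j(k := b)) m, i m))))"
    by (rule sum.swap)
  finally show ?thesis
    by (simp add: multilinear_mult_def sum_distrib_left)
qed

lemma frobenius_norm_multilinear_mult_update:
  assumes k: "k < K" and G: "G \<in> carrier_mat (p k) (p k)" and A: "A k \<in> carrier_mat (p k) (p k)"
  shows "(frobenius_norm K p n (multilinear_mult K p (A(k := G * A k)) Y))\<^sup>2 =
    (\<Sum>a<p k. \<Sum>r\<in>other_indices K p k. \<Sum>l<n.
      (\<Sum>b<p k. G $$ (a, b) * multilinear_mult K p A Y (r(k := b)) l)\<^sup>2)"
  unfolding frobenius_norm_slice[OF k]
proof (intro sum.cong refl)
  fix a r l assume "a \<in> {..<p k}" "r \<in> other_indices K p k"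
  then have "r(k := a) \<in> multi_indices K p"
    using k by (simp add: slice_in_multi_indices)
  then show "(multilinear_mult K p (A(k := G * A k)) Y (r(k := a)) l)\<^sup>2 =
      (\<Sum>b<p k. G $$ (a, b) * multilinear_mult K p A Y (r(k := b)) l)\<^sup>2"
    by (simp add: multilinear_mult_update[where K = K and p = p and A = A, OF k G A])
qed

lemma G_plus_carrier: "A \<in> G_plus q \<Longrightarrow> A \<in> carrier_mat q q"
  by (simp add: G_plus_def)

lemma G_plus_mult_closed:
  assumes A: "A \<in> G_plus q" and B: "B \<in> G_plus q"
  shows "A * B \<in> G_plus q"
proof -
  have carr: "A \<in> carrier_mat q q" "B \<in> carrier_mat q q"
    using A B by (simp_all add: G_plus_carrier)
  have entry: "(A * B) $$ (i, j) = (\<Sum>m<q. A $$ (i, m) * B $$ (m, j))" if "i < q" "j < q" for i j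
    using carr that by (simp add: scalar_prod_def atLeast0LessThan)
  have zero: "A $$ (i, m) * B $$ (m, j) = 0" if "i < q" "j < q" "m < q" "i < m \<or> m < j" for i j m
    using A B that by (auto simp: G_plus_def)
  have "(A * B) $$ (i, j) = 0" if "i < q" "j < q" "i < j" for i j
    unfolding entry[OF that(1,2)] using that zero[of i j] by (intro sum.neutral) force
  moreover have "0 < (A * B) $$ (i, i)" if i: "i < q" for i
  proof -
    have "(A * B) $$ (i, i) = A $$ (i, i) * B $$ (i, i) + (\<Sum>m\<in>{..<q} - {i}. A $$ (i, m) * B $$ (m, i))"
      unfolding entry[OF i i] using i by (simp add: sum.remove)
    also have "(\<Sum>m\<in>{..<q} - {i}. A $$ (i, m) * B $$ (m, i)) = 0"
      using i zero[of i i] by (intro sum.neutral) force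
    finally show ?thesis
      using A B i by (simp add: G_plus_def)
  qed
  moreover have "det (A * B) = 1"
    using A B by (simp add: det_mult[OF carr] G_plus_def)
  ultimately show ?thesis
    using carr by (simp add: G_plus_def)
qed

text \<open>
This is \<open>(L H)\<inverse> = H\<inverse> L\<inverse>\<close> with the inverse of \<open>H\<close> supplied explicitly as \<open>G\<close>, so that the perturbed
inverse has known entries.
\<close>

lemma matinv_mult_eq:
  assumes L: "L \<in> G_plus q" and H: "H \<in> G_plus q" and G: "G \<in> carrier_mat q q"
    and GH: "G * H = 1\<^sub>m q"
  shows "matinv (L * H) = G * matinv L"
proof -
  note inv = matinv_G_plus[OF G_plus_mult_closed[OF L H]] and invL = matinv_G_plus[OF L]
  have carr: "L \<in> carrier_mat q q" "H \<in> carrier_mat q q"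
    using L H by (simp_all add: G_plus_carrier)
  have "(G * matinv L) * (L * H) = G * ((matinv L * L) * H)"
    using carr G invL(3) by (simp add: assoc_mult_mat[of _ q q _ q _ q])
  also have "\<dots> = 1\<^sub>m q"
    using carr invL(2) GH by simp
  finally have left: "(G * matinv L) * (L * H) = 1\<^sub>m q" .
  have "G * matinv L = (G * matinv L) * ((L * H) * matinv (L * H))"
    using inv G invL(3) by simp
  also have "\<dots> = ((G * matinv L) * (L * H)) * matinv (L * H)"
    using carr G invL(3) inv(3) by (intro assoc_mult_mat[symmetric, of _ q q _ q _ q]) auto
  also have "\<dots> = matinv (L * H)"
    using left inv(3) by simp
  finally show ?thesis by simp
qed

text \<open>
The array whose norm is minimized; for a minimizer it is the core array up to the scale.
\<close>

definition whitened :: "nat \<Rightarrow> (nat \<Rightarrow> nat) \<Rightarrow> array \<Rightarrow> (nat \<Rightarrow> real mat) \<Rightarrow> array" where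
  "whitened K p X L = multilinear_mult K p (\<lambda>m. matinv (L m)) X"

text \<open>
The right-hand side is the squared norm, written row by row, of the array obtained when \<open>L k\<close> is
replaced by the feasible \<open>L k * H\<close>. In matrix terms the inequality reads \<open>tr S \<le> tr (G S G\<^sup>T)\<close> for
the Gram matrix \<open>S\<close>.
\<close>

lemma holq_minimizer_variation:
  assumes min: "holq_minimizer K p n X L" and k: "k < K"
    and H: "H \<in> G_plus (p k)" and G: "G \<in> carrier_mat (p k) (p k)" and GH: "G * H = 1\<^sub>m (p k)"
  shows "(\<Sum>a<p k. mode_gram K p n k (whitened K p X L) a a) \<le>
    (\<Sum>a<p k. \<Sum>r\<in>other_indices K p k. \<Sum>l<n. (\<Sum>b<p k. G $$ (a, b) * whitened K p X L (r(k := b)) l)\<^sup>2)"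
proof -
  let ?M = "L(k := L k * H)"
  have L: "L m \<in> G_plus (p m)" if "m < K" for m
    using min that by (simp add: holq_minimizer_def)
  have M: "\<forall>m<K. ?M m \<in> G_plus (p m)"
    using L H by (auto intro: G_plus_mult_closed)
  have upd: "(\<lambda>m. matinv (?M m)) = (\<lambda>m. matinv (L m))(k := G * matinv (L k))"
    using matinv_mult_eq[OF L[OF k] H G GH] by auto
  have "frobenius_norm K p n (whitened K p X L) \<le> frobenius_norm K p n (whitened K p X ?M)"
    using min M unfolding whitened_def holq_minimizer_def by blast
  then have "(frobenius_norm K p n (whitened K p X L))\<^sup>2 \<le> (frobenius_norm K p n (whitened K p X ?M))\<^sup>2"
    by (intro power_mono) (auto simp: frobenius_norm_def intro!: sum_nonneg)
  then show ?thesis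
    unfolding frobenius_norm_eq_trace_mode_gram[OF k, of p n "whitened K p X L"]
    by (simp only: whitened_def upd frobenius_norm_multilinear_mult_update
      [where K = K and p = p and k = k and A = "\<lambda>m. matinv (L m)", OF k G matinv_G_plus(3)[OF L[OF k]]])
qed

section \<open>Elementary perturbations\<close>

lemma addrow_mat_G_plus:
  assumes "b < a" "a < q"
  shows "addrow_mat q t a b \<in> G_plus q"
  using assms by (auto simp: G_plus_def det_addrow_mat)

lemma addrow_mat_row_sum:
  fixes x :: "nat \<Rightarrow> real"
  assumes "i < q" "b < q" "a \<noteq> b"
  shows "(\<Sum>c<q. addrow_mat q t a b $$ (i, c) * x c) = (if i = a then x a + t * x b else x i)"
proof -
  have "(\<Sum>c<q. addrow_mat q t a b $$ (i, c) * x c) =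
      (\<Sum>c<q. (if c = i then x c else 0) + (if c = b then (if i = a then t * x c else 0) else 0))"
    using assms by (intro sum.cong) (auto simp: algebra_simps)
  then show ?thesis
    using assms by (simp add: sum.distrib)
qed

text \<open>
The diagonal matrix with entries \<open>s\<close> at \<open>a\<close>, \<open>1/s\<close> at \<open>b\<close> and \<open>1\<close> elsewhere, for \<open>a \<noteq> b\<close>. As a product of
two elementary matrices its determinant and its inverse come from theirs.
\<close>

definition balance_mat :: "nat \<Rightarrow> real \<Rightarrow> nat \<Rightarrow> nat \<Rightarrow> real mat" where
  "balance_mat q s a b = multrow_mat q a s * multrow_mat q b (inverse s)"

lemma balance_mat_carrier: "balance_mat q s a b \<in> carrier_mat q q"
  unfolding balance_mat_def by (rule mult_carrier_mat[of _ q q]) simp_all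

lemma balance_mat_entry:
  assumes "i < q" "j < q" "a < q" "a \<noteq> b"
  shows "balance_mat q s a b $$ (i, j) =
    (if i \<noteq> j then 0 else if i = a then s else if i = b then inverse s else 1)"
  using assms multrow_mat[of "multrow_mat q b (inverse s)" q q a s, symmetric]
  by (auto simp: balance_mat_def)

lemma balance_mat_G_plus:
  assumes "a < q" "b < q" "a \<noteq> b" "s > 0"
  shows "balance_mat q s a b \<in> G_plus q"
proof -
  have "det (balance_mat q s a b) = 1"
    unfolding balance_mat_def using assms
    by (simp add: det_mult[of _ q] det_multrow_mat)
  then show ?thesis
    using assms by (simp add: G_plus_def balance_mat_carrier balance_mat_entry)
qed

lemma balance_mat_inverse:
  assumes "a < q" "b < q" "s \<noteq> 0"
  shows "balance_mat q s a b * balance_mat q s b a = 1\<^sub>m q"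
proof -
  let ?A = "multrow_mat q a s" and ?B = "multrow_mat q b (inverse s)"
  let ?C = "multrow_mat q b s" and ?D = "multrow_mat q a (inverse s)"
  have "balance_mat q s a b * balance_mat q s b a = ?A * ((?B * ?C) * ?D)"
    unfolding balance_mat_def by (simp add: assoc_mult_mat[of _ q q _ q _ q] mult_carrier_mat[of _ q q])
  also have "?B * ?C = 1\<^sub>m q"
    using multrow_mat_inv[of b q "inverse s"] assms by simp
  finally show ?thesis
    using multrow_mat_inv[of a q s] assms by simp
qed

lemma balance_mat_row_sum:
  fixes x :: "nat \<Rightarrow> real"
  assumes "i < q" "a < q" "a \<noteq> b"
  shows "(\<Sum>c<q. balance_mat q s a b $$ (i, c) * x c) =
    (if i = a then s else if i = b then inverse s else 1) * x i"
proof -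
  have "(\<Sum>c<q. balance_mat q s a b $$ (i, c) * x c) =
      (\<Sum>c<q. if c = i then (if i = a then s else if i = b then inverse s else 1) * x i else 0)"
    using assms by (intro sum.cong) (auto simp: balance_mat_entry)
  then show ?thesis
    using assms by simp
qed

section \<open>First-order conditions\<close>

text \<open>
A quadratic in \<open>t\<close> that vanishes at \<open>0\<close> and is nowhere negative has derivative \<open>0\<close> there. The choice
\<open>t = - x / (y + 1)\<close> gives a negative value when \<open>x \<noteq> 0\<close>; the \<open>1\<close> in the denominator covers \<open>y = 0\<close>.
\<close>

lemma linear_coeff_zero_if_quadratic_nonneg:
  fixes x y :: real
  assumes "\<And>t. 0 \<le> 2 * t * x + t\<^sup>2 * y" and "0 \<le> y"
  shows "x = 0"
proof -
  let ?t = "- x / (y + 1)"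
  have "2 * ?t * x + ?t\<^sup>2 * y = - (x\<^sup>2 * (y + 2) / (y + 1)\<^sup>2)"
    using assms(2) by (simp add: divide_simps power2_eq_square) (simp add: algebra_simps)
  then have "x\<^sup>2 * (y + 2) / (y + 1)\<^sup>2 \<le> 0"
    using assms(1)[of ?t] by linarith
  moreover have "x\<^sup>2 * (y + 2) / (y + 1)\<^sup>2 > 0" if "x \<noteq> 0"
    using that assms(2) by simp
  ultimately show ?thesis by force
qed

text \<open>
With \<open>u = s\<^sup>2\<close> the change of the sum is \<open>(u - 1) (x - y / u)\<close>. If \<open>x < y\<close>, this is negative for \<open>u > 1\<close>
close to \<open>1\<close>, so increasing the smaller of the two terms lowers the sum.
\<close>

lemma le_if_balanced_sum_minimal:
  fixes x y :: real
  assumes bal: "\<And>s. s > 0 \<Longrightarrow> x + y \<le> s\<^sup>2 * x + (inverse s)\<^sup>2 * y" and "0 \<le> x"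
  shows "y \<le> x"
proof (rule ccontr)
  assume "\<not> y \<le> x"
  with \<open>0 \<le> x\<close> have xy: "x < y" "0 < y" by simp_all
  \<comment> \<open>\<open>y / u\<close> is the midpoint of \<open>x\<close> and \<open>y\<close>, so \<open>x - y / u < 0\<close> while \<open>u > 1\<close>.\<close>
  define u where "u = 2 * y / (x + y)"
  have u: "u > 1" using xy \<open>0 \<le> x\<close> by (simp add: u_def)
  have "x + y \<le> u * x + inverse u * y"
    using bal[of "sqrt u"] u by (simp add: power_inverse)
  moreover have "u * x + inverse u * y - (x + y) = (u - 1) * (x - inverse u * y)"
    using u by (simp add: field_simps)
  moreover have "x - inverse u * y = (x - y) / 2"
    using xy \<open>0 \<le> x\<close> by (simp add: u_def field_simps)
  moreover have "(u - 1) * ((x - y) / 2) < 0"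
    using u xy by (simp add: mult_pos_neg)
  ultimately show False by simp
qed

text \<open>
The pair \<open>b < a\<close> is ordered because only additions to later rows are lower triangular; symmetry of
the Gram matrix covers the other entries.
\<close>

lemma holq_minimizer_gram_offdiag:
  assumes min: "holq_minimizer K p n X L" and k: "k < K" and ba: "b < a" "a < p k"
  shows "mode_gram K p n k (whitened K p X L) a b = 0"
proof (rule linear_coeff_zero_if_quadratic_nonneg)
  let ?S = "mode_gram K p n k (whitened K p X L)"
  show "0 \<le> ?S b b" by (rule mode_gram_diag_nonneg)
  fix t :: real
  let ?e = "\<lambda>i. \<Sum>r\<in>other_indices K p k. \<Sum>l<n.
      (\<Sum>c<p k. addrow_mat (p k) t a b $$ (i, c) * whitened K p X L (r(k := c)) l)\<^sup>2"
  have inv: "addrow_mat (p k) t a b * addrow_mat (p k) (- t) a b = 1\<^sub>m (p k)"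
    using ba by (intro addrow_mat_inv) auto
  have le: "(\<Sum>i<p k. ?S i i) \<le> (\<Sum>i<p k. ?e i)"
    by (rule holq_minimizer_variation[OF min k addrow_mat_G_plus[OF ba] _ inv]) simp
  have row: "(\<Sum>c<p k. addrow_mat (p k) t a b $$ (i, c) * x c) = (if i = a then x a + t * x b else x i)"
    if "i < p k" for i and x :: "nat \<Rightarrow> real"
    using that ba by (intro addrow_mat_row_sum) auto
  have other: "?e i = ?S i i" if "i \<in> {..<p k} - {a}" for i
    using that by (simp add: row mode_gram_def power2_eq_square del: index_mat_addrow_mat)
  have "?e a = (\<Sum>r\<in>other_indices K p k. \<Sum>l<n. (whitened K p X L (r(k := a)) l + t * whitened K p X L (r(k := b)) l)\<^sup>2)"
    using ba by (simp add: row del: index_mat_addrow_mat)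
  also have "\<dots> = ?S a a + (2 * t * ?S a b + t\<^sup>2 * ?S b b)"
    unfolding mode_gram_def sum_distrib_left sum.distrib[symmetric]
    by (simp add: power2_eq_square algebra_simps)
  finally have a: "?e a = \<dots>" .
  have split: "(\<Sum>i<p k. f i) = f a + (\<Sum>i\<in>{..<p k} - {a}. f i)" for f :: "nat \<Rightarrow> real"
    using ba by (simp add: sum.remove)
  have "(\<Sum>i\<in>{..<p k} - {a}. ?e i) = (\<Sum>i\<in>{..<p k} - {a}. ?S i i)"
    by (rule sum.cong[OF refl other])
  with le split[of ?e] split[of "\<lambda>i. ?S i i"] a show "0 \<le> 2 * t * ?S a b + t\<^sup>2 * ?S b b"
    by linarith
qed

text \<open>
Trading scale between two rows costs nothing in the determinant, so a minimizer cannot have rows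
of different length; exchanging \<open>a\<close> and \<open>b\<close> gives equality.
\<close>

lemma holq_minimizer_gram_diag_le:
  assumes min: "holq_minimizer K p n X L" and k: "k < K" and ab: "a < p k" "b < p k"
  shows "mode_gram K p n k (whitened K p X L) b b \<le> mode_gram K p n k (whitened K p X L) a a"
proof (cases "a = b")
  case False
  let ?S = "mode_gram K p n k (whitened K p X L)"
  show ?thesis
  proof (rule le_if_balanced_sum_minimal)
    show "0 \<le> ?S a a" by (rule mode_gram_diag_nonneg)
    fix s :: real assume s: "s > 0"
    let ?w = "\<lambda>i. if i = a then s else if i = b then inverse s else 1"
    let ?R = "{..<p k} - {a} - {b}"
    have "(\<Sum>i<p k. ?S i i) \<le> (\<Sum>i<p k. \<Sum>r\<in>other_indices K p k. \<Sum>l<n.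
        (\<Sum>c<p k. balance_mat (p k) s a b $$ (i, c) * whitened K p X L (r(k := c)) l)\<^sup>2)"
      by (rule holq_minimizer_variation[OF min k, where H = "balance_mat (p k) s b a"])
        (use ab s False in \<open>simp_all add: balance_mat_G_plus balance_mat_carrier balance_mat_inverse\<close>)
    also have "\<dots> = (\<Sum>i<p k. (?w i)\<^sup>2 * ?S i i)"
    proof (rule sum.cong[OF refl])
      fix i assume "i \<in> {..<p k}"
      then have row: "(\<Sum>c<p k. balance_mat (p k) s a b $$ (i, c) * x c) = ?w i * x i"
        for x :: "nat \<Rightarrow> real"
        using ab False by (intro balance_mat_row_sum) auto
      show "(\<Sum>r\<in>other_indices K p k. \<Sum>l<n.
          (\<Sum>c<p k. balance_mat (p k) s a b $$ (i, c) * whitened K p X L (r(k := c)) l)\<^sup>2) =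
          (?w i)\<^sup>2 * ?S i i"
        unfolding row power_mult_distrib mode_gram_def sum_distrib_left
        by (simp only: power2_eq_square)
    qed
    finally have le: "(\<Sum>i<p k. ?S i i) \<le> (\<Sum>i<p k. (?w i)\<^sup>2 * ?S i i)" .
    have split: "(\<Sum>i<p k. f i) = f a + (f b + (\<Sum>i\<in>?R. f i))" for f :: "nat \<Rightarrow> real"
      using ab False by (simp add: sum.remove[of _ a] sum.remove[of _ b])
    have "(\<Sum>i\<in>?R. (?w i)\<^sup>2 * ?S i i) = (\<Sum>i\<in>?R. ?S i i)"
      by (rule sum.cong) auto
    then show "?S a a + ?S b b \<le> s\<^sup>2 * ?S a a + (inverse s)\<^sup>2 * ?S b b"
      using le False unfolding split by simp
  qed
qed simp

section \<open>The core array of an incredible HOLQ\<close>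

theorem theorem2:
  fixes K n :: nat and p :: "nat \<Rightarrow> nat"
    and X Q :: array and L :: "nat \<Rightarrow> real mat" and ell :: real
  assumes "incredible_holq K p n X ell L Q"
  shows "scaled_all_orthonormal K p n Q"
  unfolding scaled_all_orthonormal_def
proof (intro allI impI)
  fix k assume k: "k < K"
  define T where "T = whitened K p X L"
  let ?S = "mode_gram K p n k T"
  have min: "holq_minimizer K p n X L" and ell: "ell = frobenius_norm K p n T" "ell > 0"
    and Q: "array_eq K p n Q (array_scale (1 / ell) T)"
    using assms unfolding incredible_holq_def T_def whitened_def by blast+
  have Qgram: "mode_gram K p n k Q a b = ?S a b / ell\<^sup>2" if "a < p k" "b < p k" for a b
  proof -
    have "Q (r(k := c)) l = T (r(k := c)) l / ell"
      if "r \<in> other_indices K p k" "l < n" "c < p k" for r l c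
      using Q that slice_in_multi_indices[OF k \<open>c < p k\<close> that(1)]
      by (simp add: array_eq_def array_scale_def)
    then show ?thesis
      using that by (simp add: mode_gram_def sum_divide_distrib power2_eq_square)
  qed
  have off: "?S a b = 0" if "a < p k" "b < p k" "a \<noteq> b" for a b
    using that holq_minimizer_gram_offdiag[OF min k, of a b]
      holq_minimizer_gram_offdiag[OF min k, of b a] mode_gram_commute[of K p n k T a b]
    by (fold T_def) (metis nat_neq_iff)
  have diag: "?S a a = ell\<^sup>2 / p k" if a: "a < p k" for a
  proof -
    have "?S b b = ?S a a" if b: "b < p k" for b
      using holq_minimizer_gram_diag_le[OF min k a b] holq_minimizer_gram_diag_le[OF min k b a]
      by (fold T_def) simp
    then have "(\<Sum>b<p k. ?S b b) = p k * ?S a a"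
      by simp
    then have "ell\<^sup>2 = p k * ?S a a"
      using frobenius_norm_eq_trace_mode_gram[OF k, of p n T] ell(1) by simp
    then show ?thesis
      using a by simp
  qed
  have "mode_gram K p n k Q a b = (if a = b then 1 / p k else 0)" if "a < p k" "b < p k" for a b
    using Qgram[OF that] off[OF that] diag[OF that(1)] ell(2) by (cases "a = b") simp_all
  then show "mode_unfolding K p n k Q * transpose_mat (mode_unfolding K p n k Q) =
      (1 / real (p k)) \<cdot>\<^sub>m 1\<^sub>m (p k)"
    unfolding mode_unfolding_gram[OF k] by (intro eq_matI) auto
qed

end
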